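(* Let $\omega$ be a weight function with $$\exists H>0:\quad \omega(t^2)=O(\omega(Ht)),\quad t\to+\infty,$$ and let $\sigma$ be a general weight function. Then the following are equivalent: (i) $\omega\preceq\sigma$, i.e. $\sigma(t)=O(\omega(t))$ as $t\to\infty$; (ii) $\mathcal{S}_{(\omega)}(\mathbb{R}^d)\subseteq\mathcal{S}_{(\sigma)}(\mathbb{R}^d)$ holds true for all dimensions $d\in\mathbb{N}$ with continuous inclusion. The spaces in (ii) can be defined by joint or separated growth at infinity, and (i)$\Rightarrow$(ii) is valid for general weight functions $\omega$ and $\sigma$. For (ii)$\Rightarrow$(i) only the inclusion for $d=1$ is required.
   Context: $\mathbb{N}_0=\mathbb{N}\cup\{0\}$. A weight function is a continuous increasing (i.e. nondecreasing) function $\omega:[0,+\infty)\to[0,+\infty)$ such that: $(\alpha)$ there is $L\ge 1$ with $\omega(2t)\le L(\omega(t)+1)$ for all $t\ge 0$; $(\beta)$ $\omega(t)=O(t^2)$ as $t\to+\infty$; $(\gamma)$ $\log t=o(\omega(t))$ as $t\to+\infty$; $(\delta)$ $\varphi_\omega(t):=\omega(e^t)$ is convex on $[0,+\infty)$. A general weight function satisfies all these properties except possibly $(\beta)$. The Young conjugate is $\varphi^*_\omega(s):=\sup_{t\ge 0}\{ts-\varphi_\omega(t)\}$, $s\ge 0$, and $W^{(\lambda)}_\alpha:=e^{\frac1\lambda\varphi^*_\omega(\lambda|\alpha|)}$ for $\lambda>0$, $\alpha\in\mathbb{N}_0^d$. $\mathcal{S}_{(\omega)}(\mathbb{R}^d)$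 is the space of all $f\in C^\infty(\mathbb{R}^d)$ such that for every $\lambda>0$ one has $\sup_{\alpha,\beta\in\mathbb{N}_0^d}\|x^\alpha\partial^\beta f\|_\infty/W^{(\lambda)}_{\alpha+\beta}<\infty$, with the projective limit topology given by these seminorms ($\|\cdot\|_\infty$ is the supremum norm on $\mathbb{R}^d$). This is the definition by joint growth at infinity; in the definition by separated growth at infinity, $W^{(\lambda)}_{\alpha+\beta}$ is replaced by $W^{(\lambda)}_\alpha W^{(\lambda)}_\beta$. *)

theory Defs
  imports "HOL-Analysis.Analysis" "HOL-Library.Landau_Symbols"
begin

section \<open>Weight functions\<close>

text \<open>Weights live on \<open>[0,\<infinity>)\<close>; the values of \<open>\<omega>\<close> at negative arguments are irrelevant.\<close>

definition general_weight_function :: "(real \<Rightarrow> real) \<Rightarrow> bool" where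
  "general_weight_function \<omega> \<longleftrightarrow>
     continuous_on {0..} \<omega> \<and> mono_on {0..} \<omega> \<and> (\<forall>t\<ge>0. \<omega> t \<ge> 0) \<and>
     (\<exists>L\<ge>1. \<forall>t\<ge>0. \<omega> (2 * t) \<le> L * (\<omega> t + 1)) \<and>
     ln \<in> o[at_top](\<omega>) \<and>
     convex_on {0..} (\<lambda>t. \<omega> (exp t))"

definition weight_function :: "(real \<Rightarrow> real) \<Rightarrow> bool" where
  "weight_function \<omega> \<longleftrightarrow> general_weight_function \<omega> \<and> \<omega> \<in> O[at_top](\<lambda>t. t ^ 2)"

definition weight_le :: "(real \<Rightarrow> real) \<Rightarrow> (real \<Rightarrow> real) \<Rightarrow> bool" (infix "\<preceq>\<^sub>w" 50) where
  "\<omega> \<preceq>\<^sub>w \<sigma> \<longleftrightarrow> \<sigma> \<in> O[at_top](\<omega>)"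

text \<open>For a general weight function the supremum is finite, since \<open>ln t = o(\<omega> t)\<close>.\<close>

definition young_conj :: "(real \<Rightarrow> real) \<Rightarrow> real \<Rightarrow> real" where
  "young_conj \<omega> s = (SUP t\<in>{0..}. t * s - \<omega> (exp t))"

section \<open>Smooth functions on \<open>\<real>\<^sup>d\<close>\<close>

text \<open>
  The dimension \<open>d\<close> is quantified over in the main statement, so \<open>\<real>\<^sup>d\<close> is the space
  \<^const>\<open>Euclidean_space\<close> \<open>d\<close> of real sequences vanishing from index \<open>d\<close> on, and
  \<open>\<nat>\<^sub>0\<^sup>d\<close> is encoded in the same way. A function on \<open>\<real>\<^sup>d\<close> is represented by its
  extension by zero to all sequences.
\<close>

definition multi_indices :: "nat \<Rightarrow> (nat \<Rightarrow> nat) set" where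
  "multi_indices d = {\<alpha>. \<forall>i\<ge>d. \<alpha> i = 0}"

definition monomial :: "nat \<Rightarrow> (nat \<Rightarrow> nat) \<Rightarrow> (nat \<Rightarrow> real) \<Rightarrow> real" where
  "monomial d \<alpha> x = (\<Prod>i<d. x i ^ \<alpha> i)"

definition partial :: "nat \<Rightarrow> ((nat \<Rightarrow> real) \<Rightarrow> complex) \<Rightarrow> (nat \<Rightarrow> real) \<Rightarrow> complex" where
  "partial i f x = vector_derivative (\<lambda>t. f (x(i := t))) (at (x i))"

definition multi_deriv ::
    "nat \<Rightarrow> (nat \<Rightarrow> nat) \<Rightarrow> ((nat \<Rightarrow> real) \<Rightarrow> complex) \<Rightarrow> (nat \<Rightarrow> real) \<Rightarrow> complex" where
  "multi_deriv d \<beta> f = fold (\<lambda>i g. (partial i ^^ \<beta> i) g) [0..<d] f"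

fun C_k :: "nat \<Rightarrow> nat \<Rightarrow> ((nat \<Rightarrow> real) \<Rightarrow> complex) \<Rightarrow> bool" where
  "C_k d 0 f \<longleftrightarrow> continuous_map (Euclidean_space d) euclidean f"
| "C_k d (Suc k) f \<longleftrightarrow> continuous_map (Euclidean_space d) euclidean f \<and>
     (\<forall>i<d. (\<forall>x\<in>topspace (Euclidean_space d). (\<lambda>t. f (x(i := t))) differentiable (at (x i)))
            \<and> C_k d k (partial i f))"

definition smooth_functions :: "nat \<Rightarrow> ((nat \<Rightarrow> real) \<Rightarrow> complex) set" where
  "smooth_functions d =
     {f. (\<forall>x. x \<notin> topspace (Euclidean_space d) \<longrightarrow> f x = 0) \<and> (\<forall>k. C_k d k f)}"

section \<open>The spaces of Beurling type\<close>

definition W :: "(real \<Rightarrow> real) \<Rightarrow> real \<Rightarrow> nat \<Rightarrow> (nat \<Rightarrow> nat) \<Rightarrow> real" where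
  "W \<omega> l d \<alpha> = exp (1 / l * young_conj \<omega> (l * real (\<Sum>i<d. \<alpha> i)))"

datatype growth = Joint | Separated

fun growth_weight ::
    "growth \<Rightarrow> (real \<Rightarrow> real) \<Rightarrow> real \<Rightarrow> nat \<Rightarrow> (nat \<Rightarrow> nat) \<Rightarrow> (nat \<Rightarrow> nat) \<Rightarrow> real" where
  "growth_weight Joint \<omega> l d \<alpha> \<beta> = W \<omega> l d (\<lambda>i. \<alpha> i + \<beta> i)"
| "growth_weight Separated \<omega> l d \<alpha> \<beta> = W \<omega> l d \<alpha> * W \<omega> l d \<beta>"

definition sup_norm :: "nat \<Rightarrow> ((nat \<Rightarrow> real) \<Rightarrow> complex) \<Rightarrow> ennreal" where
  "sup_norm d f = (SUP x\<in>topspace (Euclidean_space d). ennreal (norm (f x)))"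

definition S_seminorm ::
    "growth \<Rightarrow> nat \<Rightarrow> (real \<Rightarrow> real) \<Rightarrow> real \<Rightarrow> ((nat \<Rightarrow> real) \<Rightarrow> complex) \<Rightarrow> ennreal" where
  "S_seminorm m d \<omega> l f =
     (SUP \<alpha>\<in>multi_indices d. SUP \<beta>\<in>multi_indices d.
        sup_norm d (\<lambda>x. complex_of_real (monomial d \<alpha> x) * multi_deriv d \<beta> f x)
          / ennreal (growth_weight m \<omega> l d \<alpha> \<beta>))"

definition S_space ::
    "growth \<Rightarrow> nat \<Rightarrow> (real \<Rightarrow> real) \<Rightarrow> ((nat \<Rightarrow> real) \<Rightarrow> complex) set" where
  "S_space m d \<omega> = {f \<in> smooth_functions d. \<forall>l>0. S_seminorm m d \<omega> l f < \<infinity>}"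

text \<open>The topology generated by all balls of all seminorms in \<open>P\<close>, with arbitrary centre in \<open>V\<close>.\<close>

definition seminorm_topology ::
    "('a \<Rightarrow> complex) set \<Rightarrow> (('a \<Rightarrow> complex) \<Rightarrow> ennreal) set \<Rightarrow> ('a \<Rightarrow> complex) topology" where
  "seminorm_topology V P =
     topology_generated_by
       {{g \<in> V. p (\<lambda>x. g x - f x) < e} | f p e. f \<in> V \<and> p \<in> P \<and> e > 0}"

definition S_topology ::
    "growth \<Rightarrow> nat \<Rightarrow> (real \<Rightarrow> real) \<Rightarrow> ((nat \<Rightarrow> real) \<Rightarrow> complex) topology" where
  "S_topology m d \<omega> = seminorm_topology (S_space m d \<omega>) (S_seminorm m d \<omega> ` {0<..})"

definition continuous_inclusion ::
    "growth \<Rightarrow> nat \<Rightarrow> (real \<Rightarrow> real) \<Rightarrow> (real \<Rightarrow> real) \<Rightarrow> bool" where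
  "continuous_inclusion m d \<omega> \<sigma> \<longleftrightarrow>
     S_space m d \<omega> \<subseteq> S_space m d \<sigma> \<and>
     continuous_map (S_topology m d \<omega>) (S_topology m d \<sigma>) (\<lambda>f. f)"

end

theory Submission
  imports Defs
begin

text \<open>
  That \<open>\<sigma> = O(\<omega>)\<close> implies the inclusion is a matter of conjugation: \<open>\<sigma> \<le> C \<omega> + C\<close> gives
  \<open>\<phi>\<^sub>\<sigma>*(s) \<ge> C \<phi>\<^sub>\<omega>*(s / C) - C\<close>, so the weights for \<open>\<sigma>\<close> with parameter \<open>l\<close> dominate those for \<open>\<omega>\<close> with
  parameter \<open>l / C\<close> up to a constant (\<open>growth_weight_compare\<close>), and the seminorms compare accordingly.

  For the converse, continuity at 0 yields a seminorm for \<open>\<omega>\<close>, with some parameter \<open>l\<close>, that controls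
  the seminorm for \<open>\<sigma>\<close> with parameter 1. Both are tested on the Gaussian \<open>f\<^sub>T(x) = exp (- (x - T)\<^sup>2)\<close>
  on the line. At the peak \<open>x = T\<close> the function \<open>x ^ n f\<^sub>T\<close> has the value \<open>T ^ n\<close>. The supremum over
  \<open>n\<close> of \<open>T ^ n\<close> divided by the weight for \<open>\<sigma>\<close> is the exponential of the biconjugate, hence is
  \<open>exp (\<sigma> T)\<close> up to a factor \<open>T\<close> lost because \<open>n\<close> is an integer
  (\<open>weight_le_of_power_le_weight_seq\<close>). On the other hand, the seminorm of \<open>f\<^sub>T\<close> for \<open>\<omega>\<close> is at most a
  constant times \<open>exp (\<omega> (2 T) / l)\<close> (\<open>S_seminorm_gauss_bump\<close>). Thus
  \<open>\<sigma> T \<le> \<omega> (2 T) / l + ln T + const\<close>, which is \<open>O(\<omega> T)\<close> by the doubling condition and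
  \<open>ln = o(\<omega>)\<close>.

  This requires that the Gaussian belongs to the space for \<open>\<omega>\<close>, which fails in general for
  weights as large as \<open>t\<^sup>2\<close>. Here \<open>\<omega>(t\<^sup>2) = O(\<omega>(H t))\<close> enters: applied twice to \<open>\<omega> = O(t\<^sup>2)\<close>, it gives
  \<open>\<omega> = O(sqrt t)\<close>, and then the weights grow faster than \<open>h ^ n * n!\<close> for every \<open>h\<close>
  (\<open>fact_le_weight_seq\<close>). A crude factorial bound for the derivatives of the Gaussian is therefore
  enough.

  Joint and separated growth are treated together: seminorms for \<open>\<omega>\<close> are estimated against the
  product of two weights, which is below the joint weight, and only the multi-index \<open>\<beta> = 0\<close> is used
  for \<open>\<sigma>\<close>.
\<close>

section \<open>Weight functions and their Young conjugates\<close>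

lemma general_weight_functionD:
  assumes "general_weight_function \<omega>"
  shows weight_mono: "\<And>s t. 0 \<le> s \<Longrightarrow> s \<le> t \<Longrightarrow> \<omega> s \<le> \<omega> t"
    and weight_nonneg: "\<And>t. 0 \<le> t \<Longrightarrow> 0 \<le> \<omega> t"
    and weight_doubling: "\<exists>L\<ge>1. \<forall>t\<ge>0. \<omega> (2 * t) \<le> L * (\<omega> t + 1)"
    and weight_ln_smallo: "ln \<in> o[at_top](\<omega>)"
    and weight_convex: "convex_on {0..} (\<lambda>t. \<omega> (exp t))"
  using assms unfolding general_weight_function_def mono_on_def by auto

text \<open>
  Once \<open>s ln x \<le> \<omega> x\<close>, which is where \<open>ln = o(\<omega>)\<close> enters, the expression under the supremum is at
  most 0; only a bounded range of \<open>t\<close> remains.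
\<close>

lemma young_conj_bdd_above:
  assumes w: "general_weight_function \<omega>" and s: "0 \<le> s"
  shows "bdd_above ((\<lambda>t. t * s - \<omega> (exp t)) ` {0..})"
proof -
  have "eventually (\<lambda>x. norm (ln x) \<le> 1 / (s + 1) * norm (\<omega> x)) at_top"
    using landau_o.smallD[OF weight_ln_smallo[OF w], of "1 / (s + 1)"] s by simp
  then obtain X where X: "\<And>x. X \<le> x \<Longrightarrow> \<bar>ln x\<bar> \<le> 1 / (s + 1) * \<bar>\<omega> x\<bar>"
    unfolding eventually_at_top_linorder by auto
  define t0 where "t0 = ln (max X 1)"
  have "t * s - \<omega> (exp t) \<le> max 0 (t0 * s)" if "0 \<le> t" for t
  proof (cases "t0 \<le> t")
    case True
    then have "exp t0 \<le> exp t" by simp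
    then have "max X 1 \<le> exp t" by (simp add: t0_def)
    then have "\<bar>t\<bar> \<le> 1 / (s + 1) * \<bar>\<omega> (exp t)\<bar>" using X[of "exp t"] by simp
    then have "t * (s + 1) \<le> \<omega> (exp t)"
      using s that weight_nonneg[OF w, of "exp t"] by (simp add: field_simps)
    then show ?thesis using that by (simp add: algebra_simps)
  next
    case False
    then have "t * s \<le> t0 * s" using s by (intro mult_right_mono) auto
    then show ?thesis using weight_nonneg[OF w, of "exp t"] by simp
  qed
  then show ?thesis by (auto intro!: bdd_aboveI)
qed

lemma young_conj_upper:
  assumes "general_weight_function \<omega>" "0 \<le> s" "0 \<le> t"
  shows "t * s - \<omega> (exp t) \<le> young_conj \<omega> s"
  unfolding young_conj_def
  by (rule cSUP_upper) (use assms young_conj_bdd_above in auto)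

lemma young_conj_least:
  assumes "\<And>t. 0 \<le> t \<Longrightarrow> t * s - \<omega> (exp t) \<le> B"
  shows "young_conj \<omega> s \<le> B"
  unfolding young_conj_def by (rule cSUP_least) (use assms in auto)

lemma young_conj_mono:
  assumes w: "general_weight_function \<omega>" and "0 \<le> r" "r \<le> s"
  shows "young_conj \<omega> r \<le> young_conj \<omega> s"
proof (rule young_conj_least)
  fix t :: real assume t: "0 \<le> t"
  have "t * r \<le> t * s" using assms t by (intro mult_left_mono)
  then show "t * r - \<omega> (exp t) \<le> young_conj \<omega> s"
    using young_conj_upper[OF w _ t, of s] assms by simp
qed

text \<open>
  This is the part of the convexity of \<open>\<phi>*\<close> together with \<open>\<phi>*(0) \<le> 0\<close> that matters here. It
  follows directly from \<open>\<omega> \<ge> 0\<close>, and gives both the monotonicity of the weights in the parameter and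
  their supermultiplicativity in the index.
\<close>

lemma young_conj_starshaped:
  assumes w: "general_weight_function \<omega>" and s: "0 \<le> s" and \<theta>: "0 \<le> \<theta>" "\<theta> \<le> 1"
  shows "young_conj \<omega> (\<theta> * s) \<le> \<theta> * young_conj \<omega> s"
proof (rule young_conj_least)
  fix t :: real assume t: "0 \<le> t"
  have "\<theta> * \<omega> (exp t) \<le> 1 * \<omega> (exp t)"
    using \<theta> weight_nonneg[OF w, of "exp t"] by (intro mult_right_mono) auto
  moreover have "\<theta> * (t * s - \<omega> (exp t)) \<le> \<theta> * young_conj \<omega> s"
    using young_conj_upper[OF w s t] \<theta> by (intro mult_left_mono)
  ultimately show "t * (\<theta> * s) - \<omega> (exp t) \<le> \<theta> * young_conj \<omega> s"
    by (simp add: algebra_simps)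
qed

text \<open>
  The weights \<open>W\<close> depend on a multi-index only through its length, so all estimates take place in
  dimension-free form.
\<close>

definition weight_seq :: "(real \<Rightarrow> real) \<Rightarrow> real \<Rightarrow> nat \<Rightarrow> real" where
  "weight_seq \<omega> l n = exp (1 / l * young_conj \<omega> (l * real n))"

lemma W_eq_weight_seq: "W \<omega> l d \<alpha> = weight_seq \<omega> l (\<Sum>i<d. \<alpha> i)"
  by (simp add: W_def weight_seq_def)

lemma weight_seq_pos: "0 < weight_seq \<omega> l n"
  by (simp add: weight_seq_def)

lemma weight_seq_mono_param:
  assumes w: "general_weight_function \<omega>" and l: "0 < l" "l \<le> l'"
  shows "weight_seq \<omega> l n \<le> weight_seq \<omega> l' n"
proof -
  have "young_conj \<omega> (l / l' * (l' * real n)) \<le> l / l' * young_conj \<omega> (l' * real n)"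
    using l by (intro young_conj_starshaped[OF w]) auto
  then have "1 / l * young_conj \<omega> (l * real n) \<le> 1 / l * (l / l' * young_conj \<omega> (l' * real n))"
    using l by (intro mult_left_mono) auto
  then show ?thesis using l by (simp add: weight_seq_def)
qed

lemma weight_seq_supermult:
  assumes w: "general_weight_function \<omega>" and l: "0 < l"
  shows "weight_seq \<omega> l m * weight_seq \<omega> l n \<le> weight_seq \<omega> l (m + n)"
proof -
  let ?s = "l * real (m + n)"
  have part: "young_conj \<omega> (l * real k) \<le> real k / real (m + n) * young_conj \<omega> ?s"
    if "0 < m + n" "k \<le> m + n" for k
  proof -
    have "real k / real (m + n) * ?s = l * real k" using that by (simp del: of_nat_add)
    then show ?thesis
      using young_conj_starshaped[OF w, of ?s "real k / real (m + n)"] l that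
      by (simp del: of_nat_add)
  qed
  have "young_conj \<omega> (l * real m) + young_conj \<omega> (l * real n) \<le> young_conj \<omega> ?s"
  proof (cases "m + n = 0")
    case True
    have "young_conj \<omega> 0 \<le> 0"
      by (rule young_conj_least) (use weight_nonneg[OF w] in auto)
    then show ?thesis using True by simp
  next
    case False
    then have "real m / real (m + n) + real n / real (m + n) = 1"
      by (subst add_divide_distrib[symmetric]) (simp flip: of_nat_add)
    then have "real m / real (m + n) * young_conj \<omega> ?s + real n / real (m + n) * young_conj \<omega> ?s
      = young_conj \<omega> ?s"
      by (simp only: distrib_right[symmetric] mult_1)
    then show ?thesis using part[of m] part[of n] False by linarith
  qed
  then have "1 / l * (young_conj \<omega> (l * real m) + young_conj \<omega> (l * real n)) \<le> 1 / l * young_conj \<omega> ?s"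
    using l by (intro mult_left_mono) auto
  then show ?thesis by (simp add: weight_seq_def exp_add[symmetric] distrib_left)
qed

text \<open>
  The weight at \<open>n\<close> is the supremum over \<open>y \<ge> 1\<close> of
  \<open>y ^ n * exp (- \<omega> y / l)\<close>: a single \<open>y\<close> therefore bounds it from below.
\<close>

lemma power_le_weight_seq:
  assumes w: "general_weight_function \<omega>" and l: "0 < l" and y: "1 \<le> y"
  shows "y ^ n \<le> exp (\<omega> y / l) * weight_seq \<omega> l n"
proof -
  have "ln y * (l * real n) - \<omega> (exp (ln y)) \<le> young_conj \<omega> (l * real n)"
    using l y by (intro young_conj_upper[OF w]) auto
  then have "1 / l * (ln y * (l * real n)) \<le> 1 / l * (\<omega> y + young_conj \<omega> (l * real n))"
    using l y by (intro mult_left_mono) auto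
  then have "real n * ln y \<le> \<omega> y / l + 1 / l * young_conj \<omega> (l * real n)"
    using l by (simp add: field_simps)
  then have "exp (real n * ln y) \<le> exp (\<omega> y / l + 1 / l * young_conj \<omega> (l * real n))"
    by simp
  then show ?thesis using y by (simp add: weight_seq_def exp_add exp_of_nat_mult)
qed

lemma filterlim_weight_at_top:
  assumes w: "general_weight_function \<omega>" shows "filterlim \<omega> at_top at_top"
proof -
  have "eventually (\<lambda>x. norm (ln x) \<le> 1 * norm (\<omega> x)) at_top"
    by (rule landau_o.smallD[OF weight_ln_smallo[OF w]]) simp
  then have "eventually (\<lambda>x. ln x \<le> \<omega> x) at_top"
    using eventually_ge_at_top[of 0]
    by eventually_elim (use weight_nonneg[OF w] in auto)
  then show ?thesis by (rule filterlim_at_top_mono[OF ln_at_top])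
qed

text \<open>
  On a bounded interval the monotone function \<open>f\<close> is bounded by a constant, so an asymptotic bound
  turns into one on the whole half-line at the price of an additive constant.
\<close>

lemma bigo_imp_affine_bound:
  fixes f g :: "real \<Rightarrow> real"
  assumes fg: "f \<in> O[at_top](g)" and mono: "\<And>s t. 0 \<le> s \<Longrightarrow> s \<le> t \<Longrightarrow> f s \<le> f t"
    and g: "\<And>t. 0 \<le> t \<Longrightarrow> 0 \<le> g t"
  obtains C where "1 \<le> C" "\<And>t. 0 \<le> t \<Longrightarrow> f t \<le> C * g t + C"
proof -
  obtain c where c: "0 < c" "eventually (\<lambda>t. norm (f t) \<le> c * norm (g t)) at_top"
    using fg by (rule landau_o.bigE)
  then obtain X where X: "\<And>t. X \<le> t \<Longrightarrow> \<bar>f t\<bar> \<le> c * \<bar>g t\<bar>"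
    unfolding eventually_at_top_linorder by auto
  define C where "C = max 1 (max c (f (max X 0)))"
  have "f t \<le> C * g t + C" if t: "0 \<le> t" for t
  proof (cases "X \<le> t")
    case True
    have "f t \<le> c * g t" using X[OF True] g[OF t] by simp
    also have "\<dots> \<le> C * g t" using g[OF t] by (intro mult_right_mono) (auto simp: C_def)
    finally show ?thesis by (simp add: C_def)
  next
    case False
    then have "f t \<le> f (max X 0)" using t by (intro mono) auto
    also have "\<dots> \<le> C" by (simp add: C_def)
    finally show ?thesis using g[OF t] by (simp add: C_def add_increasing)
  qed
  then show ?thesis using that[of C] by (simp add: C_def)
qed

text \<open>
  Conjugation reverses the inequality \<open>\<sigma> \<le> C \<omega> + C\<close>, and the factor \<open>C\<close> is absorbed by rescaling
  the parameter \<open>l\<close>.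
\<close>

lemma weight_seq_compare:
  assumes w: "general_weight_function \<omega>" and v: "general_weight_function \<sigma>" and l: "0 < l"
    and C: "1 \<le> C" "\<And>t. 0 \<le> t \<Longrightarrow> \<sigma> t \<le> C * \<omega> t + C"
  shows "weight_seq \<omega> (l / C) n \<le> exp (C / l) * weight_seq \<sigma> l n"
proof -
  have "young_conj \<omega> (l / C * real n) \<le> (young_conj \<sigma> (l * real n) + C) / C"
  proof (rule young_conj_least)
    fix t :: real assume t: "0 \<le> t"
    have "t * (l * real n) - \<sigma> (exp t) \<le> young_conj \<sigma> (l * real n)"
      using l t by (intro young_conj_upper[OF v]) auto
    then have "t * (l * real n) - C * \<omega> (exp t) \<le> young_conj \<sigma> (l * real n) + C"
      using C(2)[of "exp t"] by simp
    then show "t * (l / C * real n) - \<omega> (exp t) \<le> (young_conj \<sigma> (l * real n) + C) / C"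
      using C(1) by (subst pos_le_divide_eq) (auto simp: left_diff_distrib right_diff_distrib mult_ac)
  qed
  then have "1 / (l / C) * young_conj \<omega> (l / C * real n)
      \<le> 1 / (l / C) * ((young_conj \<sigma> (l * real n) + C) / C)"
    using l C(1) by (intro mult_left_mono) auto
  also have "\<dots> = C / l + 1 / l * young_conj \<sigma> (l * real n)"
    using l C(1) by (simp add: field_simps)
  finally show ?thesis by (simp add: weight_seq_def exp_add[symmetric])
qed

lemma growth_weight_pos: "0 < growth_weight m \<omega> l d \<alpha> \<beta>"
  by (cases m) (auto simp: W_eq_weight_seq weight_seq_pos)

lemma growth_weight_mono_param:
  assumes w: "general_weight_function \<omega>" and l: "0 < l" "l \<le> l'"
  shows "growth_weight m \<omega> l d \<alpha> \<beta> \<le> growth_weight m \<omega> l' d \<alpha> \<beta>"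
  by (cases m) (auto simp: W_eq_weight_seq intro!: weight_seq_mono_param[OF w l] mult_mono
      less_imp_le[OF weight_seq_pos])

text \<open>
  Products of weights bound both kinds of growth weights from below. An estimate against
  \<open>W \<alpha> * W \<beta>\<close> thus serves the joint and the separated definition at the same time.
\<close>

lemma growth_weight_ge_product:
  assumes w: "general_weight_function \<omega>" and l: "0 < l"
  shows "W \<omega> l d \<alpha> * W \<omega> l d \<beta> \<le> growth_weight m \<omega> l d \<alpha> \<beta>"
  using weight_seq_supermult[OF w l]
  by (cases m) (auto simp: W_eq_weight_seq sum.distrib)

lemma growth_weight_compare:
  assumes "general_weight_function \<omega>" "general_weight_function \<sigma>" "\<omega> \<preceq>\<^sub>w \<sigma>" and l: "0 < l"
  shows "\<exists>l'>0. \<exists>K>0. \<forall>m d \<alpha> \<beta>. growth_weight m \<omega> l' d \<alpha> \<beta> \<le> K * growth_weight m \<sigma> l d \<alpha> \<beta>"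
proof -
  obtain C where C: "1 \<le> C" "\<And>t. 0 \<le> t \<Longrightarrow> \<sigma> t \<le> C * \<omega> t + C"
    using assms(3) weight_mono[OF assms(2)] weight_nonneg[OF assms(1)]
    unfolding weight_le_def by (rule bigo_imp_affine_bound) blast+
  note cmp = weight_seq_compare[OF assms(1,2) l C]
  have E: "1 \<le> exp (C / l)" using C(1) l by simp
  have "growth_weight m \<omega> (l / C) d \<alpha> \<beta> \<le> (exp (C / l) * exp (C / l)) * growth_weight m \<sigma> l d \<alpha> \<beta>"
    for m d \<alpha> \<beta>
  proof (cases m)
    case Joint
    \<comment> \<open>A second factor, harmless since it is at least 1, makes one constant fit both growth modes.\<close>
    have "weight_seq \<omega> (l / C) n \<le> exp (C / l) * (exp (C / l) * weight_seq \<sigma> l n)" for n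
      using order_trans[OF cmp[of n], of "exp (C / l) * (exp (C / l) * weight_seq \<sigma> l n)"]
        mult_right_mono[OF E, of "exp (C / l) * weight_seq \<sigma> l n"] weight_seq_pos[of \<sigma> l n]
      by simp
    then show ?thesis using Joint by (simp add: W_eq_weight_seq mult.assoc)
  next
    case Separated
    then show ?thesis
      using mult_mono[OF cmp cmp, of "sum \<alpha> {..<d}" "sum \<beta> {..<d}"] 
        less_imp_le[OF weight_seq_pos]
      by (simp add: W_eq_weight_seq mult_ac)
  qed
  then show ?thesis using C(1) l
    by (intro exI[of _ "l / C"] conjI exI[of _ "exp (C / l) * exp (C / l)"]) auto
qed

section \<open>Neighbourhoods in the topology of a directed family of seminorms\<close>

lemma seminorm_topology_ball_nbhd:
  fixes p :: "('a \<Rightarrow> complex) \<Rightarrow> ennreal"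
  assumes tri: "\<And>f g h. f \<in> V \<Longrightarrow> g \<in> V \<Longrightarrow> h \<in> V \<Longrightarrow>
      p (\<lambda>x. h x - f x) \<le> p (\<lambda>x. h x - g x) + p (\<lambda>x. g x - f x)"
    and "f \<in> V" "g \<in> V" and less: "p (\<lambda>x. g x - f x) < r"
  shows "\<exists>e>0. {h \<in> V. p (\<lambda>x. h x - g x) < e} \<subseteq> {h \<in> V. p (\<lambda>x. h x - f x) < r}"
proof (intro exI conjI)
  let ?e = "r - p (\<lambda>x. g x - f x)"
  show "0 < ?e" using less by (simp add: diff_gr0_ennreal)
  show "{h \<in> V. p (\<lambda>x. h x - g x) < ?e} \<subseteq> {h \<in> V. p (\<lambda>x. h x - f x) < r}"
  proof clarify
    fix h assume h: "h \<in> V" "p (\<lambda>x. h x - g x) < ?e"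
    have fin: "p (\<lambda>x. g x - f x) < top" using less by (auto intro: less_le_trans)
    have "p (\<lambda>x. h x - g x) + p (\<lambda>x. g x - f x) < r"
      using h(2) fin by (subst (asm) less_diff_eq_ennreal) auto
    then show "p (\<lambda>x. h x - f x) < r" using tri[OF \<open>f \<in> V\<close> \<open>g \<in> V\<close> h(1)] by (rule le_less_trans[rotated])
  qed
qed

text \<open>
  The subbasis consists of balls with arbitrary centres. The triangle inequality places a ball
  around each point of a subbasic set, and directedness reduces a finite intersection of balls to
  one seminorm. The centred description of open sets reduces continuity of an inclusion to
  seminorm estimates.
\<close>

lemma openin_seminorm_topology:
  fixes P :: "(('a \<Rightarrow> complex) \<Rightarrow> ennreal) set"
  assumes tri: "\<And>p f g h. p \<in> P \<Longrightarrow> f \<in> V \<Longrightarrow> g \<in> V \<Longrightarrow> h \<in> V \<Longrightarrow>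
      p (\<lambda>x. h x - f x) \<le> p (\<lambda>x. h x - g x) + p (\<lambda>x. g x - f x)"
    and zero: "\<And>p f. p \<in> P \<Longrightarrow> f \<in> V \<Longrightarrow> p (\<lambda>x. f x - f x) = 0"
    and dir: "\<And>p q. p \<in> P \<Longrightarrow> q \<in> P \<Longrightarrow> \<exists>r\<in>P. \<forall>f. p f \<le> r f \<and> q f \<le> r f"
  shows "openin (seminorm_topology V P) U \<longleftrightarrow>
    U \<subseteq> V \<and> (\<forall>g\<in>U. \<exists>p\<in>P. \<exists>e>0. {h \<in> V. p (\<lambda>x. h x - g x) < e} \<subseteq> U)"
    (is "_ \<longleftrightarrow> ?R U")
proof
  assume "openin (seminorm_topology V P) U"
  then have "generate_topology_on {{g \<in> V. p (\<lambda>x. g x - f x) < e} | f p e. f \<in> V \<and> p \<in> P \<and> e > 0} U"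
    unfolding seminorm_topology_def by (rule openin_topology_generated_by)
  then show "?R U"
  proof induct
    case Empty
    then show ?case by simp
  next
    case (Int a b)
    have "\<exists>r\<in>P. \<exists>e>0. {h \<in> V. r (\<lambda>x. h x - g x) < e} \<subseteq> a \<inter> b" if g: "g \<in> a" "g \<in> b" for g
    proof -
      obtain p e where p: "p \<in> P" "e > 0" "{h \<in> V. p (\<lambda>x. h x - g x) < e} \<subseteq> a"
        using Int(2) g by blast
      obtain q e' where q: "q \<in> P" "e' > 0" "{h \<in> V. q (\<lambda>x. h x - g x) < e'} \<subseteq> b"
        using Int(4) g by blast
      obtain r where r: "r \<in> P" "\<And>f. p f \<le> r f" "\<And>f. q f \<le> r f"
        using dir[OF p(1) q(1)] by blast
      have "{h \<in> V. r (\<lambda>x. h x - g x) < min e e'} \<subseteq> a \<inter> b"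
      proof
        fix h assume "h \<in> {h \<in> V. r (\<lambda>x. h x - g x) < min e e'}"
        then have h: "h \<in> V" "r (\<lambda>x. h x - g x) < e" "r (\<lambda>x. h x - g x) < e'" by auto
        show "h \<in> a \<inter> b"
          using le_less_trans[OF r(2) h(2)] le_less_trans[OF r(3) h(3)] h(1) p(3) q(3) by auto
      qed
      moreover have "0 < min e e'" using p(2) q(2) by simp
      ultimately show ?thesis using r(1) by blast
    qed
    then show ?case using Int(2) by auto
  next
    case (UN K)
    have "\<exists>r\<in>P. \<exists>e>0. {h \<in> V. r (\<lambda>x. h x - g x) < e} \<subseteq> \<Union>K" if g: "g \<in> k" "k \<in> K" for g k
    proof -
      obtain p e where "p \<in> P" "e > 0" "{h \<in> V. p (\<lambda>x. h x - g x) < e} \<subseteq> k"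
        using UN(2)[OF g(2)] g(1) by blast
      then show ?thesis using g(2) by blast
    qed
    then show ?case using UN(2) by blast
  next
    case (Basis s)
    then obtain f p e where s: "s = {g \<in> V. p (\<lambda>x. g x - f x) < e}" "f \<in> V" "p \<in> P" by blast
    have "\<exists>e'>0. {h \<in> V. p (\<lambda>x. h x - g x) < e'} \<subseteq> s" if "g \<in> s" for g
      unfolding s(1)
      by (rule seminorm_topology_ball_nbhd) (use that s tri in auto)
    then show ?case using s by blast
  qed
next
  assume R: "?R U"
  let ?B = "{{g \<in> V. p (\<lambda>x. g x - f x) < e} | f p e. f \<in> V \<and> p \<in> P \<and> (e::ennreal) > 0}"
  have "U = \<Union>{B \<in> ?B. B \<subseteq> U}"
  proof
    show "U \<subseteq> \<Union>{B \<in> ?B. B \<subseteq> U}"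
    proof
      fix g assume g: "g \<in> U"
      then obtain p e where p: "p \<in> P" "e > 0" "{h \<in> V. p (\<lambda>x. h x - g x) < e} \<subseteq> U" using R by blast
      have gV: "g \<in> V" using g R by blast
      have "{h \<in> V. p (\<lambda>x. h x - g x) < e} \<in> ?B" using p gV by blast
      moreover have "g \<in> {h \<in> V. p (\<lambda>x. h x - g x) < e}" using zero[OF p(1) gV] p gV by simp
      ultimately show "g \<in> \<Union>{B \<in> ?B. B \<subseteq> U}" using p(3) by blast
    qed
  qed blast
  then show "openin (seminorm_topology V P) U"
    unfolding seminorm_topology_def openin_topology_generated_by_iff
    by (metis (no_types, lifting) generate_topology_on.Basis generate_topology_on.UN mem_Collect_eq)
qed

section \<open>Seminorms on spaces of smooth functions\<close>

lemma S_seminorm_le_iff: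
  "S_seminorm m d \<omega> l f \<le> B \<longleftrightarrow>
    (\<forall>\<alpha>\<in>multi_indices d. \<forall>\<beta>\<in>multi_indices d. \<forall>x\<in>topspace (Euclidean_space d).
       ennreal (\<bar>monomial d \<alpha> x\<bar> * norm (multi_deriv d \<beta> f x) / growth_weight m \<omega> l d \<alpha> \<beta>) \<le> B)"
  by (simp add: S_seminorm_def sup_norm_def SUP_divide_ennreal SUP_le_iff divide_ennreal
      growth_weight_pos norm_mult)

lemma S_seminorm_bound:
  assumes "\<alpha> \<in> multi_indices d" "\<beta> \<in> multi_indices d" "x \<in> topspace (Euclidean_space d)"
  shows "ennreal (\<bar>monomial d \<alpha> x\<bar> * norm (multi_deriv d \<beta> f x) / growth_weight m \<omega> l d \<alpha> \<beta>)
    \<le> S_seminorm m d \<omega> l f"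
  using S_seminorm_le_iff[of m d \<omega> l f "S_seminorm m d \<omega> l f"] assms by blast

lemma S_seminorm_le_mult:
  assumes K: "0 < K" and le: "\<And>\<alpha> \<beta>. growth_weight m \<omega> l d \<alpha> \<beta> \<le> K * growth_weight m \<sigma> l' d \<alpha> \<beta>"
  shows "S_seminorm m d \<sigma> l' f \<le> ennreal K * S_seminorm m d \<omega> l f"
  unfolding S_seminorm_le_iff
proof (intro ballI)
  fix \<alpha> \<beta> x
  assume I: "\<alpha> \<in> multi_indices d" "\<beta> \<in> multi_indices d" "x \<in> topspace (Euclidean_space d)"
  let ?N = "\<bar>monomial d \<alpha> x\<bar> * norm (multi_deriv d \<beta> f x)"
  have "?N / growth_weight m \<sigma> l' d \<alpha> \<beta> = K * (?N / (K * growth_weight m \<sigma> l' d \<alpha> \<beta>))"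
    using K by simp
  also have "\<dots> \<le> K * (?N / growth_weight m \<omega> l d \<alpha> \<beta>)"
    using K le[of \<alpha> \<beta>] by (intro mult_left_mono divide_left_mono mult_pos_pos growth_weight_pos) auto
  finally have "ennreal (?N / growth_weight m \<sigma> l' d \<alpha> \<beta>) \<le> ennreal K * ennreal (?N / growth_weight m \<omega> l d \<alpha> \<beta>)"
    using K by (subst ennreal_mult'[symmetric]) (auto intro: ennreal_leI simp: less_imp_le)
  also have "\<dots> \<le> ennreal K * S_seminorm m d \<omega> l f"
    by (intro mult_left_mono S_seminorm_bound I) auto
  finally show "ennreal (?N / growth_weight m \<sigma> l' d \<alpha> \<beta>) \<le> ennreal K * S_seminorm m d \<omega> l f" .
qed

lemma S_seminorm_antimono_param:
  assumes "general_weight_function \<omega>" "0 < l" "l \<le> l'"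
  shows "S_seminorm m d \<omega> l' f \<le> S_seminorm m d \<omega> l f"
  using S_seminorm_le_mult[of 1 m \<omega> l d \<omega> l' f] growth_weight_mono_param[OF assms] by simp

lemma fun_upd_notin_Euclidean_space:
  assumes "i < d" "x \<notin> topspace (Euclidean_space d)"
  shows "x(i := t) \<notin> topspace (Euclidean_space d)"
  using assms by (auto simp: topspace_Euclidean_space)

text \<open>
  Outside \<open>\<real>\<^sup>d\<close> the coordinate lines stay outside, so there a smooth function is constantly 0
  along them. Hence linearity of the partial derivatives holds as an equation between functions and
  can be iterated.
\<close>

lemma partial_diff:
  assumes f: "f \<in> smooth_functions d" and g: "g \<in> smooth_functions d" and i: "i < d"
  shows "partial i (\<lambda>x. f x - g x) = (\<lambda>x. partial i f x - partial i g x)"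
proof
  fix x
  show "partial i (\<lambda>x. f x - g x) x = partial i f x - partial i g x"
  proof (cases "x \<in> topspace (Euclidean_space d)")
    case True
    have "C_k d (Suc 0) f" "C_k d (Suc 0) g" using f g by (auto simp: smooth_functions_def simp del: C_k.simps)
    then show ?thesis using True i by (simp add: partial_def)
  next
    case False
    then have "f (x(i := t)) = 0" "g (x(i := t)) = 0" for t
      using f g fun_upd_notin_Euclidean_space[OF i] by (auto simp: smooth_functions_def)
    then show ?thesis by (simp add: partial_def)
  qed
qed

lemma partial_smooth:
  assumes f: "f \<in> smooth_functions d" and i: "i < d"
  shows "partial i f \<in> smooth_functions d"
proof -
  have "C_k d k (partial i f)" for k
  proof -
    have "C_k d (Suc k) f" using f by (simp add: smooth_functions_def del: C_k.simps)
    then show ?thesis using i by simp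
  qed
  moreover have "partial i f x = 0" if "x \<notin> topspace (Euclidean_space d)" for x
  proof -
    have "f (x(i := t)) = 0" for t
      using f fun_upd_notin_Euclidean_space[OF i that] by (auto simp: smooth_functions_def)
    then show ?thesis by (simp add: partial_def)
  qed
  ultimately show ?thesis by (simp add: smooth_functions_def)
qed

lemma partial_power_smooth:
  assumes "f \<in> smooth_functions d" "i < d"
  shows "(partial i ^^ k) f \<in> smooth_functions d"
  using assms by (induction k) (auto simp: partial_smooth)

lemma partial_power_diff:
  assumes "f \<in> smooth_functions d" "g \<in> smooth_functions d" "i < d"
  shows "(partial i ^^ k) (\<lambda>x. f x - g x) = (\<lambda>x. (partial i ^^ k) f x - (partial i ^^ k) g x)"
  using assms by (induction k) (auto simp: partial_diff[OF partial_power_smooth partial_power_smooth])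

lemma multi_deriv_diff:
  assumes "f \<in> smooth_functions d" "g \<in> smooth_functions d"
  shows "multi_deriv d \<beta> (\<lambda>x. f x - g x) = (\<lambda>x. multi_deriv d \<beta> f x - multi_deriv d \<beta> g x)"
proof -
  have "fold (\<lambda>i g. (partial i ^^ \<beta> i) g) xs (\<lambda>x. f x - g x) =
      (\<lambda>x. fold (\<lambda>i g. (partial i ^^ \<beta> i) g) xs f x - fold (\<lambda>i g. (partial i ^^ \<beta> i) g) xs g x)"
    if "set xs \<subseteq> {..<d}" for xs
    using that assms
    by (induction xs arbitrary: f g) (auto simp: partial_power_diff partial_power_smooth)
  from this[of "[0..<d]"] show ?thesis unfolding multi_deriv_def by (simp add: lessThan_atLeast0)
qed

text \<open>
  The functions are required to be smooth because the derivative of a difference splits only for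
  differentiable functions.
\<close>

lemma S_seminorm_triangle:
  assumes "f \<in> smooth_functions d" "g \<in> smooth_functions d" "h \<in> smooth_functions d"
  shows "S_seminorm m d \<omega> l (\<lambda>x. h x - f x)
    \<le> S_seminorm m d \<omega> l (\<lambda>x. h x - g x) + S_seminorm m d \<omega> l (\<lambda>x. g x - f x)"
  unfolding S_seminorm_le_iff
proof (intro ballI)
  fix \<alpha> \<beta> x
  assume I: "\<alpha> \<in> multi_indices d" "\<beta> \<in> multi_indices d" "x \<in> topspace (Euclidean_space d)"
  let ?c = "\<bar>monomial d \<alpha> x\<bar>" and ?w = "growth_weight m \<omega> l d \<alpha> \<beta>"
  let ?N = "\<lambda>f g. norm (multi_deriv d \<beta> (\<lambda>x. f x - g x) x)"
  have "?N h f \<le> ?N h g + ?N g f"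
    using assms norm_triangle_ineq[of "multi_deriv d \<beta> h x - multi_deriv d \<beta> g x"
        "multi_deriv d \<beta> g x - multi_deriv d \<beta> f x"]
    by (simp add: multi_deriv_diff)
  then have "?c * ?N h f / ?w \<le> ?c * (?N h g + ?N g f) / ?w"
    by (intro divide_right_mono mult_left_mono less_imp_le[OF growth_weight_pos]) auto
  then have "ennreal (?c * ?N h f / ?w) \<le> ennreal (?c * ?N h g / ?w) + ennreal (?c * ?N g f / ?w)"
    by (subst ennreal_plus[symmetric])
      (auto intro!: ennreal_leI divide_nonneg_pos growth_weight_pos
        simp: distrib_left add_divide_distrib simp del: ennreal_plus)
  also have "\<dots> \<le> S_seminorm m d \<omega> l (\<lambda>x. h x - g x) + S_seminorm m d \<omega> l (\<lambda>x. g x - f x)"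
    by (intro add_mono S_seminorm_bound I)
  finally show "ennreal (?c * ?N h f / ?w) \<le> \<dots>" .
qed

lemma S_seminorm_self_diff:
  assumes "f \<in> smooth_functions d"
  shows "S_seminorm m d \<omega> l (\<lambda>x. f x - f x) = 0"
proof -
  have "S_seminorm m d \<omega> l (\<lambda>x. f x - f x) \<le> 0"
    unfolding S_seminorm_le_iff multi_deriv_diff[OF assms assms] by simp
  then show ?thesis by simp
qed

lemma S_space_subset_smooth: "S_space m d \<omega> \<subseteq> smooth_functions d"
  by (auto simp: S_space_def)

lemma openin_S_topology:
  assumes w: "general_weight_function \<omega>"
  shows "openin (S_topology m d \<omega>) U \<longleftrightarrow> U \<subseteq> S_space m d \<omega> \<and>
    (\<forall>g\<in>U. \<exists>l>0. \<exists>e>0. {h \<in> S_space m d \<omega>. S_seminorm m d \<omega> l (\<lambda>x. h x - g x) < e} \<subseteq> U)"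
proof -
  have dir: "\<exists>r\<in>S_seminorm m d \<omega> ` {0<..}. \<forall>f. p f \<le> r f \<and> q f \<le> r f"
    if "p \<in> S_seminorm m d \<omega> ` {0<..}" "q \<in> S_seminorm m d \<omega> ` {0<..}" for p q
  proof -
    obtain a b where "p = S_seminorm m d \<omega> a" "q = S_seminorm m d \<omega> b" "a > 0" "b > 0"
      using \<open>p \<in> _\<close> \<open>q \<in> _\<close> by blast
    then show ?thesis
      by (intro bexI[of _ "S_seminorm m d \<omega> (min a b)"]) (auto intro!: S_seminorm_antimono_param[OF w])
  qed
  have tri: "p (\<lambda>x. h x - f x) \<le> p (\<lambda>x. h x - g x) + p (\<lambda>x. g x - f x)"
    if "p \<in> S_seminorm m d \<omega> ` {0<..}" "f \<in> S_space m d \<omega>" "g \<in> S_space m d \<omega>" "h \<in> S_space m d \<omega>"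
    for p f g h
    using that S_space_subset_smooth by (blast intro: S_seminorm_triangle)
  have zero: "p (\<lambda>x. f x - f x) = 0"
    if "p \<in> S_seminorm m d \<omega> ` {0<..}" "f \<in> S_space m d \<omega>" for p f
    using that S_space_subset_smooth by (blast intro: S_seminorm_self_diff)
  have "openin (S_topology m d \<omega>) U \<longleftrightarrow> U \<subseteq> S_space m d \<omega> \<and>
    (\<forall>g\<in>U. \<exists>p\<in>S_seminorm m d \<omega> ` {0<..}. \<exists>e>0. {h \<in> S_space m d \<omega>. p (\<lambda>x. h x - g x) < e} \<subseteq> U)"
    unfolding S_topology_def
    by (rule openin_seminorm_topology) (rule tri zero dir; assumption)+
  then show ?thesis by (simp add: Bex_def)
qed

lemma topspace_S_topology:
  assumes w: "general_weight_function \<omega>"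
  shows "topspace (S_topology m d \<omega>) = S_space m d \<omega>"
proof (rule antisym)
  show "topspace (S_topology m d \<omega>) \<subseteq> S_space m d \<omega>"
    using openin_topspace[of "S_topology m d \<omega>"] unfolding openin_S_topology[OF w] by blast
  have "openin (S_topology m d \<omega>) (S_space m d \<omega>)"
    unfolding openin_S_topology[OF w] by (auto intro!: exI[of _ "1::real"] exI[of _ "1::ennreal"])
  then show "S_space m d \<omega> \<subseteq> topspace (S_topology m d \<omega>)" by (rule openin_subset)
qed

text \<open>
  If \<open>\<sigma> = O(\<omega>)\<close> then every seminorm for \<open>\<sigma>\<close> is bounded by a multiple of one for \<open>\<omega>\<close>, because the
  weights compare the other way round.
\<close>

theorem weight_le_imp_continuous_inclusion:
  assumes w: "general_weight_function \<omega>" and v: "general_weight_function \<sigma>" and le: "\<omega> \<preceq>\<^sub>w \<sigma>"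
  shows "continuous_inclusion m d \<omega> \<sigma>"
proof -
  have bound: "\<exists>l'>0. \<exists>K>0. \<forall>f. S_seminorm m d \<sigma> l f \<le> ennreal K * S_seminorm m d \<omega> l' f" if l: "0 < l" for l
  proof -
    obtain l' K where "l' > 0" "K > 0"
      "\<And>\<alpha> \<beta>. growth_weight m \<omega> l' d \<alpha> \<beta> \<le> K * growth_weight m \<sigma> l d \<alpha> \<beta>"
      using growth_weight_compare[OF w v le l] by blast
    then show ?thesis using S_seminorm_le_mult[of K m \<omega> l' d \<sigma> l] by blast
  qed
  have sub: "S_space m d \<omega> \<subseteq> S_space m d \<sigma>"
  proof
    fix f assume f: "f \<in> S_space m d \<omega>"
    have "S_seminorm m d \<sigma> l f < \<infinity>" if l: "0 < l" for l
    proof -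
      obtain l' K where K: "0 < l'" "S_seminorm m d \<sigma> l f \<le> ennreal K * S_seminorm m d \<omega> l' f"
        using bound[OF l] by blast
      have "S_seminorm m d \<omega> l' f < top" using f K(1) by (simp add: S_space_def)
      then have "ennreal K * S_seminorm m d \<omega> l' f < top" by (simp add: ennreal_mult_less_top)
      with K(2) show ?thesis by (auto intro: le_less_trans)
    qed
    then show "f \<in> S_space m d \<sigma>" using f by (simp add: S_space_def)
  qed
  have "openin (S_topology m d \<omega>) {f \<in> S_space m d \<omega>. f \<in> U}" if U: "openin (S_topology m d \<sigma>) U" for U
    unfolding openin_S_topology[OF w]
  proof (intro conjI ballI)
    fix g assume g: "g \<in> {f \<in> S_space m d \<omega>. f \<in> U}"
    then obtain l e where ball: "l > 0" "e > 0"
        "{h \<in> S_space m d \<sigma>. S_seminorm m d \<sigma> l (\<lambda>x. h x - g x) < e} \<subseteq> U"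
      using U unfolding openin_S_topology[OF v] by blast
    obtain l' K where K: "l' > 0" "K > 0" "\<And>f. S_seminorm m d \<sigma> l f \<le> ennreal K * S_seminorm m d \<omega> l' f"
      using bound[OF ball(1)] by blast
    have "S_seminorm m d \<sigma> l f < e" if "S_seminorm m d \<omega> l' f < e / ennreal K" for f
    proof -
      have "ennreal K * S_seminorm m d \<omega> l' f < ennreal K * (e / ennreal K)"
        using that K by (intro ennreal_mult_strict_left_mono) auto
      also have "\<dots> = e" using K
        by (simp add: ennreal_times_divide mult.commute[of "ennreal K"] mult_divide_eq_ennreal)
      finally show ?thesis using K(3) by (rule le_less_trans[rotated])
    qed
    moreover have "0 < e / ennreal K" using ball(2) by (simp add: ennreal_zero_less_divide)
    ultimately show "\<exists>l>0. \<exists>e>0. {h \<in> S_space m d \<omega>. S_seminorm m d \<omega> l (\<lambda>x. h x - g x) < e}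
        \<subseteq> {f \<in> S_space m d \<omega>. f \<in> U}"
      using K(1) ball(3) sub by (intro exI[of _ l'] conjI exI[of _ "e / ennreal K"]) auto
  qed auto
  then show ?thesis
    unfolding continuous_inclusion_def continuous_map_def topspace_S_topology[OF w] topspace_S_topology[OF v]
    using sub by auto
qed

text \<open>
  Continuity at 0: directedness of the seminorms for \<open>\<omega>\<close> allows a single one of them to control a
  given seminorm for \<open>\<sigma>\<close>.
\<close>

lemma continuous_inclusion_imp_seminorm_bound:
  assumes w: "general_weight_function \<omega>" and v: "general_weight_function \<sigma>"
    and ci: "continuous_inclusion m d \<omega> \<sigma>" and zero: "(\<lambda>x. 0) \<in> S_space m d \<omega>" and l: "0 < l"
  shows "\<exists>l'>0. \<exists>e>0. \<forall>h\<in>S_space m d \<omega>. S_seminorm m d \<omega> l' h < e \<longrightarrow> S_seminorm m d \<sigma> l h < 1"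
proof -
  define U where "U = {h \<in> S_space m d \<sigma>. S_seminorm m d \<sigma> l (\<lambda>x. h x - 0) < 1}"
  define U' where "U' = {f \<in> topspace (S_topology m d \<omega>). f \<in> U}"
  have sub: "S_space m d \<omega> \<subseteq> S_space m d \<sigma>" using ci by (simp add: continuous_inclusion_def)
  have zs: "(\<lambda>x. 0) \<in> smooth_functions d" using zero by (simp add: S_space_def)
  have z: "(\<lambda>x. 0) \<in> S_space m d \<sigma>" using zero sub by (rule rev_subsetD)
  have p: "S_seminorm m d \<sigma> l \<in> S_seminorm m d \<sigma> ` {0<..}" using l by simp
  \<comment> \<open>The difference with 0 is kept in the term so that \<open>U\<close> is literally a ball with centre 0.\<close>
  have "openin (S_topology m d \<sigma>) U"
    unfolding S_topology_def seminorm_topology_def U_def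
    by (rule topology_generated_by_Basis, rule CollectI, rule exI[of _ "\<lambda>x. 0"],
        rule exI[of _ "S_seminorm m d \<sigma> l"], rule exI[of _ 1]) (simp add: z p)
  then have "openin (S_topology m d \<omega>) U'"
    using ci unfolding continuous_inclusion_def continuous_map_def U'_def by simp
  moreover have "(\<lambda>x. 0) \<in> U'"
    using zero z S_seminorm_self_diff[OF zs, of m \<sigma> l]
    by (simp add: U'_def U_def topspace_S_topology[OF w])
  ultimately have "\<exists>l'>0. \<exists>e>0. {h \<in> S_space m d \<omega>. S_seminorm m d \<omega> l' (\<lambda>x. h x - (\<lambda>x. 0) x) < e} \<subseteq> U'"
    unfolding openin_S_topology[OF w] by (elim conjE) (erule (1) bspec)
  then obtain l' e where l': "l' > 0" "e > 0" and
    "{h \<in> S_space m d \<omega>. S_seminorm m d \<omega> l' (\<lambda>x. h x - (\<lambda>x. 0) x) < e} \<subseteq> U'"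
    by (elim exE conjE)
  then have "\<forall>h\<in>S_space m d \<omega>. S_seminorm m d \<omega> l' h < e \<longrightarrow> S_seminorm m d \<sigma> l h < 1"
    by (simp add: subset_iff U'_def U_def)
  with l' show ?thesis by blast
qed

section \<open>Derivatives of the Gaussian\<close>

text \<open>
  The derivatives of \<open>exp (- x\<^sup>2)\<close>, that is, up to sign the Hermite polynomials times the Gaussian,
  given by their three-term recursion: differentiating \<open>g' = - 2 x g\<close> repeatedly expresses each
  derivative through the two preceding ones.
\<close>

fun gauss_deriv :: "nat \<Rightarrow> real \<Rightarrow> real" where
  "gauss_deriv 0 x = exp (- x\<^sup>2)"
| "gauss_deriv (Suc 0) x = - 2 * x * exp (- x\<^sup>2)"
| "gauss_deriv (Suc (Suc n)) x = - 2 * x * gauss_deriv (Suc n) x - 2 * (real n + 1) * gauss_deriv n x"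

lemma gauss_deriv_has_derivative:
  "(gauss_deriv n has_real_derivative gauss_deriv (Suc n) x) (at x)"
proof (induction n x rule: gauss_deriv.induct)
  case (1 x)
  have "((\<lambda>x. exp (- x\<^sup>2)) has_real_derivative - 2 * x * exp (- x\<^sup>2)) (at x)"
    by (auto intro!: derivative_eq_intros)
  then show ?case by simp
next
  case (2 x)
  have "((\<lambda>x. - 2 * x * exp (- x\<^sup>2)) has_real_derivative
      - 2 * x * (- 2 * x * exp (- x\<^sup>2)) - 2 * exp (- x\<^sup>2)) (at x)"
    by (auto intro!: derivative_eq_intros)
  then show ?case by simp
next
  case (3 n x)
  have "((\<lambda>x. - 2 * x * gauss_deriv (Suc n) x - 2 * (real n + 1) * gauss_deriv n x) has_real_derivative
     - 2 * x * gauss_deriv (Suc (Suc n)) x - 2 * (real (Suc n) + 1) * gauss_deriv (Suc n) x) (at x)"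
    using "3.IH" by (auto intro!: derivative_eq_intros simp: algebra_simps)
  then show ?case by simp
qed

lemma power_le_fact_exp:
  fixes x :: real assumes "0 \<le> x" shows "x ^ n \<le> fact n * exp x"
proof -
  have "(\<Sum>k\<in>{n}. x ^ k /\<^sub>R fact k) \<le> (\<Sum>k. x ^ k /\<^sub>R fact k)"
    using assms by (intro sum_le_suminf summable_exp_generic) auto
  then have "x ^ n / fact n \<le> exp x" by (simp add: exp_def field_simps)
  then show ?thesis by (simp add: field_simps)
qed

lemma fact_add_le: "(fact (m + n) :: real) \<le> 2 ^ (m + n) * fact m * fact n"
proof -
  have "fact m * fact n * real (m + n choose m) = fact (m + n)"
    using binomial_fact_lemma[of m "m + n"] by (metis add_diff_cancel_left' le_add1 of_nat_fact of_nat_mult)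
  moreover have "real (m + n choose m) \<le> 2 ^ (m + n)"
    using binomial_le_pow2[of "m + n" m] by (metis of_nat_le_iff of_nat_numeral of_nat_power)
  ultimately show ?thesis
    using mult_left_mono[of "real (m + n choose m)" "2 ^ (m + n)" "fact m * fact n"] by (simp add: mult_ac)
qed

lemma power_times_gauss_bound:
  fixes x :: real shows "\<bar>x\<bar> ^ a * exp (- x\<^sup>2) \<le> 3 * fact a"
proof -
  have "\<bar>x\<bar> - x\<^sup>2 \<le> 1"
    using zero_le_power2[of "\<bar>x\<bar> - 1"] by (simp add: power2_diff)
  then have "exp (\<bar>x\<bar> - x\<^sup>2) \<le> exp 1" by simp
  also have "\<dots> \<le> (3::real)" by (rule exp_le)
  finally have e: "exp (\<bar>x\<bar> - x\<^sup>2) \<le> 3" .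
  have "\<bar>x\<bar> ^ a * exp (- x\<^sup>2) \<le> fact a * exp \<bar>x\<bar> * exp (- x\<^sup>2)"
    by (intro mult_right_mono power_le_fact_exp) auto
  also have "\<dots> = fact a * exp (\<bar>x\<bar> - x\<^sup>2)" by (simp add: exp_diff exp_minus field_simps)
  also have "\<dots> \<le> fact a * 3" using e by (intro mult_left_mono) auto
  finally show ?thesis by simp
qed

text \<open>
  The first term of the recursion trades a derivative for a power of \<open>x\<close> and keeps \<open>a + n\<close>; the
  second drops two derivatives, which pays for its factor \<open>n + 1\<close>. So a bound in terms of
  \<open>(a + n)!\<close> propagates, and \<open>3 ^ n\<close> leaves the room \<open>2 * 3 + 2 \<le> 9\<close> that the induction step needs.
  Factorials overestimate the true size, but the weights below grow faster still.
\<close>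

lemma gauss_deriv_bound: "\<bar>x\<bar> ^ a * \<bar>gauss_deriv n x\<bar> \<le> 3 * 3 ^ n * fact (a + n)"
proof (induction n x arbitrary: a rule: gauss_deriv.induct)
  case (1 x)
  show ?case using power_times_gauss_bound[of x a] by simp
next
  case (2 x)
  have "\<bar>x\<bar> ^ a * \<bar>gauss_deriv (Suc 0) x\<bar> = 2 * (\<bar>x\<bar> ^ Suc a * exp (- x\<^sup>2))"
    by (simp add: abs_mult)
  also have "\<dots> \<le> 2 * (3 * fact (Suc a))"
    by (intro mult_left_mono power_times_gauss_bound) auto
  also have "\<dots> \<le> 3 * (3 * fact (Suc a))" by (intro mult_right_mono) auto
  finally show ?case by simp
next
  case (3 n x)
  let ?F = "fact (a + Suc (Suc n)) :: real"
  have "\<bar>x\<bar> ^ a * \<bar>gauss_deriv (Suc (Suc n)) x\<bar>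
      \<le> \<bar>x\<bar> ^ a * (2 * \<bar>x\<bar> * \<bar>gauss_deriv (Suc n) x\<bar> + 2 * (real n + 1) * \<bar>gauss_deriv n x\<bar>)"
    using abs_triangle_ineq4[of "- 2 * x * gauss_deriv (Suc n) x" "2 * (real n + 1) * gauss_deriv n x"]
    by (intro mult_left_mono) (auto simp: abs_mult)
  also have "\<dots> = 2 * (\<bar>x\<bar> ^ Suc a * \<bar>gauss_deriv (Suc n) x\<bar>) + 2 * ((real n + 1) * (\<bar>x\<bar> ^ a * \<bar>gauss_deriv n x\<bar>))"
    by (simp add: algebra_simps)
  also have "\<dots> \<le> 2 * (3 * 3 ^ Suc n * ?F) + 2 * (3 * 3 ^ n * ?F)"
  proof (intro add_mono mult_left_mono)
    show "\<bar>x\<bar> ^ Suc a * \<bar>gauss_deriv (Suc n) x\<bar> \<le> 3 * 3 ^ Suc n * ?F"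
      using "3.IH"(1)[of "Suc a"] by simp
    have "(real n + 1) * fact (a + n) \<le> (real (Suc (a + n)) * fact (a + n) :: real)"
      by (intro mult_right_mono) auto
    also have "\<dots> = fact (Suc (a + n))" by simp
    also have "\<dots> \<le> ?F" by (intro fact_mono) simp
    finally have f: "(real n + 1) * fact (a + n) \<le> ?F" .
    have "(real n + 1) * (\<bar>x\<bar> ^ a * \<bar>gauss_deriv n x\<bar>) \<le> (real n + 1) * (3 * 3 ^ n * fact (a + n))"
      using "3.IH"(2)[of a] by (intro mult_left_mono) auto
    also have "\<dots> = 3 * 3 ^ n * ((real n + 1) * fact (a + n))" by simp
    also have "\<dots> \<le> 3 * 3 ^ n * ?F" using f by (intro mult_left_mono) auto
    finally show "(real n + 1) * (\<bar>x\<bar> ^ a * \<bar>gauss_deriv n x\<bar>) \<le> 3 * 3 ^ n * ?F" .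
  qed auto
  also have "\<dots> = 8 * (3 * 3 ^ n * ?F)" by simp
  also have "\<dots> \<le> 9 * (3 * 3 ^ n * ?F)" by (intro mult_right_mono) auto
  finally show ?case by simp
qed

text \<open>
  Since \<open>\<bar>x\<bar> \<le> 2 max(\<bar>x - T\<bar>, T)\<close>, translating the Gaussian to \<open>T\<close> adds to the estimate
  at the origin a term with \<open>(2 T) ^ a\<close> in place of the powers of \<open>x\<close>. The constant 12 collects a factor 2 from this splitting, 2 from \<open>fact_add_le\<close> and 3
  from \<open>gauss_deriv_bound\<close>.
\<close>

lemma gauss_deriv_translate_bound:
  assumes T: "0 \<le> T"
  shows "\<bar>x\<bar> ^ a * \<bar>gauss_deriv b (x - T)\<bar>
    \<le> 3 * ((12 ^ a * fact a) * (12 ^ b * fact b)) + 3 * ((2 * T) ^ a * (12 ^ b * fact b))"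
proof -
  let ?y = "x - T" and ?g = "\<bar>gauss_deriv b (x - T)\<bar>"
  have "\<bar>x\<bar> \<le> \<bar>?y\<bar> + T" using T by linarith
  also have "\<dots> \<le> 2 * max \<bar>?y\<bar> T" by (simp add: max_def)
  finally have "\<bar>x\<bar> ^ a \<le> (2 * max \<bar>?y\<bar> T) ^ a" by (intro power_mono) auto
  also have "\<dots> \<le> 2 ^ a * \<bar>?y\<bar> ^ a + (2 * T) ^ a"
    using T by (auto simp: max_def power_mult_distrib)
  finally have "\<bar>x\<bar> ^ a * ?g \<le> (2 ^ a * \<bar>?y\<bar> ^ a + (2 * T) ^ a) * ?g"
    by (intro mult_right_mono) auto
  also have "\<dots> = 2 ^ a * (\<bar>?y\<bar> ^ a * ?g) + (2 * T) ^ a * ?g" by (simp add: algebra_simps)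
  also have "\<dots> \<le> 3 * ((12 ^ a * fact a) * (12 ^ b * fact b)) + (2 * T) ^ a * (3 * (12 ^ b * fact b))"
  proof (intro add_mono mult_left_mono)
    have "(2::real) ^ a * (\<bar>?y\<bar> ^ a * ?g) \<le> 2 ^ a * (3 * 3 ^ b * fact (a + b))"
      by (intro mult_left_mono gauss_deriv_bound) auto
    also have "\<dots> \<le> 2 ^ a * (3 * 3 ^ b * (2 ^ (a + b) * fact a * fact b))"
      by (intro mult_left_mono fact_add_le) auto
    also have "\<dots> = 3 * ((4 ^ a * fact a) * (6 ^ b * fact b))"
    proof -
      have "(4::real) ^ a = 2 ^ a * 2 ^ a" "(6::real) ^ b = 3 ^ b * 2 ^ b"
        by (simp_all flip: power_mult_distrib)
      then show ?thesis by (simp add: power_add mult_ac)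
    qed
    also have "\<dots> \<le> 3 * ((12 ^ a * fact a) * (12 ^ b * fact b))"
      by (intro mult_left_mono mult_mono mult_right_mono power_mono) auto
    finally show "2 ^ a * (\<bar>?y\<bar> ^ a * ?g) \<le> 3 * ((12 ^ a * fact a) * (12 ^ b * fact b))" .
    have "?g \<le> 3 * (3 ^ b * fact b)" using gauss_deriv_bound[of ?y 0 b] by simp
    also have "\<dots> \<le> 3 * (12 ^ b * fact b)"
      by (intro mult_left_mono mult_right_mono power_mono) auto
    finally show "?g \<le> 3 * (12 ^ b * fact b)" .
  qed (use T in auto)
  finally show ?thesis by (simp add: mult_ac)
qed

section \<open>Weights that dominate the factorials\<close>

text \<open>
  The condition halves the order of growth each time it is used: \<open>O(t\<^sup>2)\<close> becomes \<open>O(t)\<close> and then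
  \<open>O(sqrt t)\<close>.
\<close>

lemma weight_sqrt_growth:
  assumes w: "weight_function \<omega>" and H: "0 < H" "(\<lambda>t. \<omega> (t ^ 2)) \<in> O[at_top](\<lambda>t. \<omega> (H * t))"
  obtains A where "0 \<le> A" "\<And>t. 0 \<le> t \<Longrightarrow> \<omega> t \<le> A * sqrt t + A"
proof -
  have g: "general_weight_function \<omega>" using w by (simp add: weight_function_def)
  note mono = weight_mono[OF g] and nonneg = weight_nonneg[OF g]
  obtain C where C: "1 \<le> C" "\<And>t. 0 \<le> t \<Longrightarrow> \<omega> (t\<^sup>2) \<le> C * \<omega> (H * t) + C"
    by (rule bigo_imp_affine_bound[OF H(2)]) (use mono nonneg H(1) in \<open>auto intro: power_mono\<close>)
  obtain D where D: "1 \<le> D" "\<And>t. 0 \<le> t \<Longrightarrow> \<omega> t \<le> D * t\<^sup>2 + D"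
    by (rule bigo_imp_affine_bound[of \<omega> "\<lambda>t. t\<^sup>2"]) (use w mono in \<open>auto simp: weight_function_def\<close>)
  have half: "\<omega> t \<le> C * \<omega> (H * sqrt t) + C" if "0 \<le> t" for t
    using C(2)[of "sqrt t"] that by simp
  have est: "\<omega> t \<le> C * (C * (D * (H ^ 3 * sqrt t) + D) + C) + C" if t: "0 \<le> t" for t
  proof -
    have "(H * sqrt (H * sqrt t))\<^sup>2 = H ^ 3 * sqrt t"
      using H(1) t by (simp add: power_mult_distrib eval_nat_numeral)
    then have "\<omega> (H * sqrt (H * sqrt t)) \<le> D * (H ^ 3 * sqrt t) + D"
      using D(2)[of "H * sqrt (H * sqrt t)"] H(1) t by simp
    then have "C * \<omega> (H * sqrt (H * sqrt t)) + C \<le> C * (D * (H ^ 3 * sqrt t) + D) + C"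
      using C(1) by (intro add_right_mono mult_left_mono) auto
    then have "\<omega> (H * sqrt t) \<le> C * (D * (H ^ 3 * sqrt t) + D) + C"
      using half[of "H * sqrt t"] H(1) t by simp
    then have "C * \<omega> (H * sqrt t) + C \<le> C * (C * (D * (H ^ 3 * sqrt t) + D) + C) + C"
      using C(1) by (intro add_right_mono mult_left_mono) auto
    then show ?thesis using half[OF t] by simp
  qed
  define A where "A = C * C * D * H ^ 3 + (C * C * D + C * C + C)"
  have A: "0 \<le> A" "C * C * D * H ^ 3 \<le> A" "C * C * D + C * C + C \<le> A"
    using C(1) D(1) H(1) by (auto simp: A_def)
  have "\<omega> t \<le> A * sqrt t + A" if t: "0 \<le> t" for t
  proof -
    have "\<omega> t \<le> C * C * D * H ^ 3 * sqrt t + (C * C * D + C * C + C)"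
      using est[OF t] by (simp add: algebra_simps)
    also have "\<dots> \<le> A * sqrt t + A" using A t by (intro add_mono mult_right_mono) auto
    finally show ?thesis .
  qed
  with A(1) show ?thesis by (rule that)
qed

text \<open>
  Evaluating \<open>power_le_weight_seq\<close> at \<open>y = (n + 1)\<^sup>2\<close> loses only \<open>exp (A (n + 2) / l)\<close>, so the weights
  grow at least like \<open>(n + 1) ^ (2 n)\<close> up to a geometric factor. This beats \<open>h ^ n * n!\<close> for every
  \<open>h\<close> and \<open>l\<close>, which puts the Gaussian in the space for \<open>\<omega>\<close>.
\<close>

lemma fact_le_weight_seq:
  assumes w: "general_weight_function \<omega>" and l: "0 < l" and h: "0 \<le> h"
    and A: "0 \<le> A" "\<And>t. 0 \<le> t \<Longrightarrow> \<omega> t \<le> A * sqrt t + A"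
  obtains K where "0 < K" "\<And>n. h ^ n * fact n \<le> K * weight_seq \<omega> l n"
proof -
  define B where "B = h * exp (A / l)"
  have B: "0 \<le> B" using h by (simp add: B_def)
  have "h ^ n * fact n \<le> exp B * exp (2 * A / l) * weight_seq \<omega> l n" for n
  proof -
    let ?N = "real n + 1"
    have "(fact n :: real) \<le> real (n ^ n)" by (rule fact_le_power)
    also have "\<dots> \<le> ?N ^ n" by (simp add: power_mono)
    finally have fact: "fact n \<le> ?N ^ n" .
    have "B ^ n \<le> fact n * exp B" by (rule power_le_fact_exp[OF B])
    also have "\<dots> \<le> ?N ^ n * exp B" using fact by (intro mult_right_mono) auto
    finally have BN: "B ^ n \<le> ?N ^ n * exp B" .
    have "\<omega> (?N\<^sup>2) / l \<le> (A * ?N + A) / l"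
      using A(2)[of "?N\<^sup>2"] l by (intro divide_right_mono) auto
    also have "\<dots> = real n * (A / l) + 2 * A / l" using l by (simp add: field_simps)
    finally have "exp (\<omega> (?N\<^sup>2) / l) \<le> exp (real n * (A / l)) * exp (2 * A / l)"
      by (simp add: exp_add[symmetric])
    then have ex: "exp (\<omega> (?N\<^sup>2) / l) \<le> exp (A / l) ^ n * exp (2 * A / l)"
      by (simp only: exp_of_nat_mult)
    have "(?N\<^sup>2) ^ n \<le> exp (\<omega> (?N\<^sup>2) / l) * weight_seq \<omega> l n"
      by (rule power_le_weight_seq[OF w l]) simp
    also have "\<dots> \<le> exp (A / l) ^ n * exp (2 * A / l) * weight_seq \<omega> l n"
      using ex less_imp_le[OF weight_seq_pos] by (intro mult_right_mono)
    finally have "h ^ n * (?N\<^sup>2) ^ n \<le> h ^ n * (exp (A / l) ^ n * exp (2 * A / l) * weight_seq \<omega> l n)"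
      using h by (intro mult_left_mono) auto
    also have "\<dots> = B ^ n * (exp (2 * A / l) * weight_seq \<omega> l n)"
      by (simp add: B_def power_mult_distrib)
    also have "\<dots> \<le> (?N ^ n * exp B) * (exp (2 * A / l) * weight_seq \<omega> l n)"
      using BN less_imp_le[OF weight_seq_pos] by (intro mult_right_mono) auto
    finally have "?N ^ n * (h ^ n * ?N ^ n) \<le> ?N ^ n * (exp B * exp (2 * A / l) * weight_seq \<omega> l n)"
      by (simp add: power2_eq_square power_mult_distrib mult_ac)
    then have "h ^ n * ?N ^ n \<le> exp B * exp (2 * A / l) * weight_seq \<omega> l n"
      by (rule mult_left_le_imp_le) simp
    moreover have "h ^ n * fact n \<le> h ^ n * ?N ^ n" using fact h by (intro mult_left_mono) auto
    ultimately show ?thesis by linarith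
  qed
  then show ?thesis using that[of "exp B * exp (2 * A / l)"] by simp
qed

section \<open>Translated Gaussians as test functions\<close>

text \<open>
  The order \<open>n\<close> of the derivative is a parameter so that partial differentiation just raises it by
  one; the height \<open>c\<close> allows the bump to be scaled into a given neighbourhood of 0.
\<close>

definition gauss_bump :: "real \<Rightarrow> real \<Rightarrow> nat \<Rightarrow> (nat \<Rightarrow> real) \<Rightarrow> complex" where
  "gauss_bump c T n x =
    (if x \<in> topspace (Euclidean_space 1) then complex_of_real (c * gauss_deriv n (x 0 - T)) else 0)"

lemma gauss_bump_has_vector_derivative:
  assumes x: "x \<in> topspace (Euclidean_space 1)"
  shows "((\<lambda>t. gauss_bump c T n (x(0 := t))) has_vector_derivative gauss_bump c T (Suc n) x) (at (x 0))"
proof -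
  have "x(0 := t) \<in> topspace (Euclidean_space 1)" for t using x by (auto simp: topspace_Euclidean_space)
  then have eq: "(\<lambda>t. gauss_bump c T n (x(0 := t))) = (\<lambda>t. complex_of_real (c * gauss_deriv n (t - T)))"
    by (simp add: gauss_bump_def)
  have "((\<lambda>t. gauss_deriv n (t - T)) has_real_derivative gauss_deriv (Suc n) (x 0 - T)) (at (x 0))"
    using gauss_deriv_has_derivative[of n "x 0 + - T"] unfolding DERIV_shift by simp
  then have "((\<lambda>t. c * gauss_deriv n (t - T)) has_real_derivative c * gauss_deriv (Suc n) (x 0 - T)) (at (x 0))"
    by (rule DERIV_cmult)
  then have "((\<lambda>t. complex_of_real (c * gauss_deriv n (t - T))) has_vector_derivative
      complex_of_real (c * gauss_deriv (Suc n) (x 0 - T))) (at (x 0))"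
    by (intro has_vector_derivative_of_real) (simp add: has_real_derivative_iff_has_vector_derivative)
  then show ?thesis using x unfolding eq by (simp add: gauss_bump_def del: gauss_deriv.simps)
qed

lemma partial_gauss_bump: "partial 0 (gauss_bump c T n) = gauss_bump c T (Suc n)"
proof
  fix x
  show "partial 0 (gauss_bump c T n) x = gauss_bump c T (Suc n) x"
  proof (cases "x \<in> topspace (Euclidean_space 1)")
    case True
    then show ?thesis
      unfolding partial_def by (intro vector_derivative_at gauss_bump_has_vector_derivative)
  next
    case False
    then have "x(0 := t) \<notin> topspace (Euclidean_space 1)" for t
      by (intro fun_upd_notin_Euclidean_space) auto
    then show ?thesis using False by (simp add: partial_def gauss_bump_def)
  qed
qed

lemma gauss_bump_smooth: "gauss_bump c T n \<in> smooth_functions 1"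
proof -
  have cont: "continuous_map (Euclidean_space 1) euclidean (gauss_bump c T n)" for n
  proof -
    have "isCont (gauss_deriv n) y" for y
      using gauss_deriv_has_derivative by (rule DERIV_isCont)
    then have g: "continuous_on UNIV (gauss_deriv n)"
      by (simp add: continuous_at_imp_continuous_on)
    have "continuous_on (topspace (Euclidean_space 1)) (\<lambda>x. x 0 - T)"
      by (rule continuous_on_diff[OF _ continuous_on_const],
          rule continuous_on_subset[OF continuous_on_product_coordinates subset_UNIV])
    then have "continuous_on (topspace (Euclidean_space 1)) (\<lambda>x. gauss_deriv n (x 0 - T))"
      by (rule continuous_on_compose2[OF g]) simp
    then have "continuous_on (topspace (Euclidean_space 1)) (\<lambda>x. complex_of_real (c * gauss_deriv n (x 0 - T)))"
      by (intro continuous_on_of_real continuous_on_mult_left)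
    then have "continuous_on (topspace (Euclidean_space 1)) (gauss_bump c T n)"
      by (rule continuous_on_eq) (simp add: gauss_bump_def)
    then show ?thesis by (simp add: continuous_map_Euclidean_space_iff)
  qed
  have "C_k 1 k (gauss_bump c T n)" for k
  proof (induction k arbitrary: n)
    case 0
    show ?case using cont by simp
  next
    case (Suc k)
    have "(\<lambda>t. gauss_bump c T n (x(0 := t))) differentiable at (x 0)"
      if "x \<in> topspace (Euclidean_space 1)" for x
      using gauss_bump_has_vector_derivative[OF that] by (rule differentiableI_vector)
    then show ?case using cont Suc by (simp add: partial_gauss_bump[simplified])
  qed
  then show ?thesis by (auto simp: smooth_functions_def gauss_bump_def)
qed

lemma multi_deriv_gauss_bump: "multi_deriv 1 \<beta> (gauss_bump c T 0) = gauss_bump c T (\<beta> 0)"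
proof -
  have "(partial 0 ^^ k) (gauss_bump c T 0) = gauss_bump c T k" for k
    by (induction k) (auto simp: partial_gauss_bump)
  then show ?thesis by (simp add: multi_deriv_def)
qed

text \<open>
  The \<open>l\<close>-seminorm of the translate grows at most like \<open>exp (\<omega> (2 T) / l)\<close>: in
  \<open>gauss_deriv_translate_bound\<close> the factorials are below the weights by assumption, and
  \<open>(2 T) ^ a\<close> is at most \<open>exp (\<omega> (2 T) / l)\<close> times the weight.
\<close>

lemma S_seminorm_gauss_bump:
  assumes w: "general_weight_function \<omega>" and l: "0 < l" and T: "1 \<le> T" and c: "0 \<le> c"
    and K: "0 < K" "\<And>n. 12 ^ n * fact n \<le> K * weight_seq \<omega> l n"
  shows "S_seminorm m 1 \<omega> l (gauss_bump c T 0) \<le> ennreal (c * ((3 * K\<^sup>2 + 3 * K) * exp (\<omega> (2 * T) / l)))"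
  unfolding S_seminorm_le_iff multi_deriv_gauss_bump
proof (intro ballI ennreal_leI)
  fix \<alpha> \<beta> :: "nat \<Rightarrow> nat" and x :: "nat \<Rightarrow> real"
  assume x: "x \<in> topspace (Euclidean_space 1)"
  let ?a = "\<alpha> 0" and ?b = "\<beta> 0" and ?w = "weight_seq \<omega> l" and ?E = "exp (\<omega> (2 * T) / l)"
  have wp: "0 \<le> ?w n" for n by (simp add: less_imp_le weight_seq_pos)
  have E: "1 \<le> ?E" using l T weight_nonneg[OF w, of "2 * T"] by simp
  have "\<bar>x 0\<bar> ^ ?a * \<bar>gauss_deriv ?b (x 0 - T)\<bar>
    \<le> 3 * ((12 ^ ?a * fact ?a) * (12 ^ ?b * fact ?b)) + 3 * ((2 * T) ^ ?a * (12 ^ ?b * fact ?b))"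
    using T by (intro gauss_deriv_translate_bound) auto
  also have "\<dots> \<le> 3 * ((K * ?w ?a) * (K * ?w ?b)) + 3 * ((?E * ?w ?a) * (K * ?w ?b))"
    using T K(1) wp by (intro add_mono mult_left_mono mult_mono K(2) power_le_weight_seq[OF w l]) auto
  also have "\<dots> = (3 * K\<^sup>2 + 3 * K * ?E) * (?w ?a * ?w ?b)" by (simp add: power2_eq_square algebra_simps)
  also have "\<dots> \<le> ((3 * K\<^sup>2 + 3 * K) * ?E) * (?w ?a * ?w ?b)"
    using mult_left_mono[OF E, of "3 * K\<^sup>2"] wp by (intro mult_right_mono) (auto simp: distrib_right)
  also have "?w ?a * ?w ?b \<le> growth_weight m \<omega> l 1 \<alpha> \<beta>"
    using growth_weight_ge_product[OF w l, of 1 \<alpha> \<beta> m] by (simp add: W_eq_weight_seq)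
  finally have *: "\<bar>x 0\<bar> ^ ?a * \<bar>gauss_deriv ?b (x 0 - T)\<bar>
    \<le> ((3 * K\<^sup>2 + 3 * K) * ?E) * growth_weight m \<omega> l 1 \<alpha> \<beta>"
    using K(1) by (simp add: mult_left_mono)
  have "\<bar>monomial 1 \<alpha> x\<bar> * norm (gauss_bump c T ?b x) = c * (\<bar>x 0\<bar> ^ ?a * \<bar>gauss_deriv ?b (x 0 - T)\<bar>)"
    using x c by (simp add: monomial_def gauss_bump_def power_abs abs_mult norm_mult del: of_real_mult)
  also have "\<dots> \<le> c * (((3 * K\<^sup>2 + 3 * K) * ?E) * growth_weight m \<omega> l 1 \<alpha> \<beta>)"
    using * c by (intro mult_left_mono)
  finally show "\<bar>monomial 1 \<alpha> x\<bar> * norm (gauss_bump c T ?b x) / growth_weight m \<omega> l 1 \<alpha> \<beta>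
    \<le> c * ((3 * K\<^sup>2 + 3 * K) * ?E)"
    using growth_weight_pos[of m \<omega> l 1 \<alpha> \<beta>] by (simp add: pos_divide_le_eq mult_ac)
qed

text \<open>
  Only the value \<open>c * T ^ n\<close> of \<open>x ^ n f\<close> at the peak \<open>x = T\<close> is used. In the separated case the
  additional factor is the weight at 0, which is at most 1.
\<close>

lemma power_le_of_S_seminorm_gauss_bump:
  assumes v: "general_weight_function \<sigma>" and T: "0 \<le> T" and c: "0 \<le> c"
    and less: "S_seminorm m 1 \<sigma> 1 (gauss_bump c T 0) < 1"
  shows "c * T ^ n \<le> weight_seq \<sigma> 1 n"
proof -
  let ?\<alpha> = "\<lambda>i::nat. if i = 0 then n else 0" and ?x = "\<lambda>i::nat. if i = 0 then T else 0"
  let ?\<beta> = "\<lambda>i::nat. 0::nat"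
  have x: "?x \<in> topspace (Euclidean_space 1)" by (simp add: topspace_Euclidean_space)
  have "ennreal (\<bar>monomial 1 ?\<alpha> ?x\<bar> * norm (multi_deriv 1 ?\<beta> (gauss_bump c T 0) ?x) / growth_weight m \<sigma> 1 1 ?\<alpha> ?\<beta>)
     \<le> S_seminorm m 1 \<sigma> 1 (gauss_bump c T 0)"
    using x by (intro S_seminorm_bound) (auto simp: multi_indices_def)
  also note less
  finally have "\<bar>monomial 1 ?\<alpha> ?x\<bar> * norm (multi_deriv 1 ?\<beta> (gauss_bump c T 0) ?x) / growth_weight m \<sigma> 1 1 ?\<alpha> ?\<beta> < 1"
    by (simp add: ennreal_less_one_iff)
  then have "T ^ n * c < growth_weight m \<sigma> 1 1 ?\<alpha> ?\<beta>"
    using x c T growth_weight_pos[of m \<sigma> 1 1 ?\<alpha> ?\<beta>]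
    by (simp add: multi_deriv_gauss_bump[simplified] monomial_def gauss_bump_def)
  also have "\<dots> \<le> weight_seq \<sigma> 1 n"
  proof -
    have "young_conj \<sigma> 0 \<le> 0" by (rule young_conj_least) (use weight_nonneg[OF v] in auto)
    then have "weight_seq \<sigma> 1 0 \<le> 1" by (simp add: weight_seq_def)
    then show ?thesis
      using mult_left_mono[of "weight_seq \<sigma> 1 0" 1 "weight_seq \<sigma> 1 n"] weight_seq_pos[of \<sigma> 1 n]
      by (cases m) (auto simp: W_eq_weight_seq)
  qed
  finally show ?thesis by (simp add: mult_ac)
qed

text \<open>
  Biconjugation: a supporting line of slope \<open>s\<close> to the convex function \<open>\<sigma> (exp t)\<close> at \<open>t = ln T\<close> gives
  \<open>\<phi>*(s) \<le> s t - \<sigma> T\<close>. The hypothesis speaks of integers only; replacing \<open>s\<close> by its integer part costs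
  the summand \<open>ln T\<close>, which is negligible against a weight function.
\<close>

lemma weight_le_of_power_le_weight_seq:
  assumes v: "general_weight_function \<sigma>" and T: "1 < T" and c: "0 < c"
    and le: "\<And>n. c * T ^ n \<le> weight_seq \<sigma> 1 n"
  shows "\<sigma> T \<le> ln T - ln c"
proof -
  define t where "t = ln T"
  have t: "0 < t" "exp t = T" using T by (auto simp: t_def)
  define s where "s = Inf ((\<lambda>u. (\<sigma> (exp t) - \<sigma> (exp u)) / (t - u)) ` ({t<..} \<inter> {0..}))"
  have sub: "\<sigma> (exp t) + s * (u - t) \<le> \<sigma> (exp u)" if "0 \<le> u" for u
    unfolding s_def using weight_convex[OF v] t(1) that by (intro convex_le_Inf_differential) auto
  have s: "0 \<le> s"
  proof -
    have "\<sigma> (exp 0) \<le> \<sigma> (exp t)" using t(1) by (intro weight_mono[OF v]) auto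
    then have "0 \<le> s * t" using sub[of 0] by simp
    then show ?thesis using t(1) by (simp add: zero_le_mult_iff)
  qed
  define n where "n = nat \<lfloor>s\<rfloor>"
  have n: "real n \<le> s" "s \<le> real n + 1" using s by (auto simp: n_def)
  have "young_conj \<sigma> s \<le> s * t - \<sigma> T"
  proof (rule young_conj_least)
    fix u :: real assume "0 \<le> u"
    then show "u * s - \<sigma> (exp u) \<le> s * t - \<sigma> T" using sub[of u] t(2) by (simp add: algebra_simps)
  qed
  moreover have "young_conj \<sigma> (real n) \<le> young_conj \<sigma> s" using n(1) by (intro young_conj_mono[OF v]) auto
  moreover have "ln c + real n * t \<le> young_conj \<sigma> (real n)"
  proof -
    have "ln (c * T ^ n) \<le> ln (weight_seq \<sigma> 1 n)" using le[of n] c T by (subst ln_le_cancel_iff) (auto simp: weight_seq_pos)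
    then show ?thesis using c T by (simp add: weight_seq_def ln_mult ln_realpow t_def)
  qed
  moreover have "s * t \<le> real n * t + t" using mult_right_mono[OF n(2), of t] t(1) by (simp add: algebra_simps)
  ultimately show ?thesis by (simp add: t_def)
qed

text \<open>
  The height \<open>c\<close> of the Gaussian centred at \<open>T\<close> is chosen so that its \<open>l\<close>-seminorm for \<open>\<omega>\<close> is within
  the radius supplied by continuity. The seminorm for \<open>\<sigma>\<close> is then below 1, which bounds \<open>\<sigma> T\<close> by
  \<open>- ln c + ln T\<close>, and \<open>- ln c\<close> is essentially \<open>\<omega> (2 T) / l\<close>.
\<close>

theorem continuous_inclusion_imp_weight_le:
  assumes w: "weight_function \<omega>" and H: "0 < H" "(\<lambda>t. \<omega> (t ^ 2)) \<in> O[at_top](\<lambda>t. \<omega> (H * t))"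
    and v: "general_weight_function \<sigma>" and ci: "continuous_inclusion m 1 \<omega> \<sigma>"
  shows "\<omega> \<preceq>\<^sub>w \<sigma>"
proof -
  have g: "general_weight_function \<omega>" using w by (simp add: weight_function_def)
  obtain A where A: "0 \<le> A" "\<And>t. 0 \<le> t \<Longrightarrow> \<omega> t \<le> A * sqrt t + A"
    using weight_sqrt_growth[OF w H] by blast
  have fact: "\<exists>K>0. \<forall>n. 12 ^ n * fact n \<le> K * weight_seq \<omega> l n" if "0 < l" for l
    using fact_le_weight_seq[OF g that _ A, of 12] by auto
  have bump: "gauss_bump c T 0 \<in> S_space m 1 \<omega>" if "0 \<le> c" "1 \<le> T" for c T
  proof -
    have "S_seminorm m 1 \<omega> l (gauss_bump c T 0) < \<infinity>" if l: "0 < l" for l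
      using fact[OF l] S_seminorm_gauss_bump[OF g l \<open>1 \<le> T\<close> \<open>0 \<le> c\<close>, of _ m]
      by (metis ennreal_less_top infinity_ennreal_def le_less_trans)
    then show ?thesis using gauss_bump_smooth by (simp add: S_space_def)
  qed
  \<comment> \<open>A Gaussian of height 0 witnesses that the zero function is in the space.\<close>
  have "gauss_bump 0 1 0 = (\<lambda>x. 0)" by (auto simp: gauss_bump_def)
  then have zero: "(\<lambda>x. 0) \<in> S_space m 1 \<omega>" using bump[of 0 1] by simp
  obtain l e where l: "0 < l" and e: "0 < e"
    "\<And>h. h \<in> S_space m 1 \<omega> \<Longrightarrow> S_seminorm m 1 \<omega> l h < e \<Longrightarrow> S_seminorm m 1 \<sigma> 1 h < 1"
    using continuous_inclusion_imp_seminorm_bound[OF g v ci zero, of 1] by auto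
  obtain e' where e': "0 < e'" "e' < e" using dense[OF e(1)] by blast
  then have "e' < top" using less_trans top.not_eq_extremum by fastforce
  then obtain r where r: "0 < r" "ennreal r < e"
    using e' by (cases e') auto
  obtain K where K: "0 < K" "\<And>n. 12 ^ n * fact n \<le> K * weight_seq \<omega> l n" using fact[OF l] by blast
  obtain L where L: "1 \<le> L" "\<And>t. 0 \<le> t \<Longrightarrow> \<omega> (2 * t) \<le> L * (\<omega> t + 1)" using weight_doubling[OF g] by blast
  define K' where "K' = 3 * K\<^sup>2 + 3 * K"
  have K': "0 < K'" using K(1) by (simp add: K'_def add_pos_pos)
  define b where "b = L / l + ln (K' / r)"
  have est: "\<sigma> T \<le> ln T + L / l * \<omega> T + b" if T: "1 < T" for T
  proof -
    define c where "c = r / (K' * exp (\<omega> (2 * T) / l))"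
    have c: "0 < c" using r K' by (simp add: c_def)
    have "S_seminorm m 1 \<omega> l (gauss_bump c T 0) \<le> ennreal (c * (K' * exp (\<omega> (2 * T) / l)))"
      unfolding K'_def using T c by (intro S_seminorm_gauss_bump[OF g l _ _ K]) auto
    also have "c * (K' * exp (\<omega> (2 * T) / l)) = r" using K' by (simp add: c_def)
    also note r(2)
    finally have "S_seminorm m 1 \<sigma> 1 (gauss_bump c T 0) < 1" using bump[of c T] c T e(2) by simp
    then have "c * T ^ n \<le> weight_seq \<sigma> 1 n" for n
      using c T by (intro power_le_of_S_seminorm_gauss_bump[OF v]) auto
    then have "\<sigma> T \<le> ln T - ln c" by (rule weight_le_of_power_le_weight_seq[OF v T c])
    also have "ln c = - ln (K' / r) - \<omega> (2 * T) / l" using r K' by (simp add: c_def ln_div ln_mult)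
    finally have "\<sigma> T \<le> ln T + ln (K' / r) + \<omega> (2 * T) / l" by simp
    also have "\<omega> (2 * T) / l \<le> L * (\<omega> T + 1) / l" using L(2)[of T] T l by (intro divide_right_mono) auto
    also have "ln T + ln (K' / r) + L * (\<omega> T + 1) / l = ln T + L / l * \<omega> T + b"
      by (simp add: b_def field_simps add_divide_distrib)
    finally show ?thesis by simp
  qed
  have "eventually (\<lambda>T. norm (ln T) \<le> 1 * norm (\<omega> T)) at_top"
    by (rule landau_o.smallD[OF weight_ln_smallo[OF g]]) simp
  moreover have "eventually (\<lambda>T. b \<le> \<omega> T) at_top"
    using filterlim_weight_at_top[OF g] by (simp add: filterlim_at_top)
  ultimately have "eventually (\<lambda>T. norm (\<sigma> T) \<le> (2 + L / l) * norm (\<omega> T)) at_top"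
    using eventually_gt_at_top[of 1]
  proof eventually_elim
    case (elim T)
    then show ?case
      using est[of T] weight_nonneg[OF g, of T] weight_nonneg[OF v, of T] by (simp add: distrib_right)
  qed
  then show ?thesis unfolding weight_le_def by (rule landau_o.bigI[rotated]) (use L l in \<open>simp add: add_pos_pos\<close>)
qed

section \<open>Inclusion of the spaces and comparison of the weights\<close>

theorem theorem6p7:
  fixes \<omega> \<sigma> :: "real \<Rightarrow> real" and m :: growth
  shows
    "(weight_function \<omega> \<and> (\<exists>H>0. (\<lambda>t. \<omega> (t ^ 2)) \<in> O[at_top](\<lambda>t. \<omega> (H * t)))
        \<and> general_weight_function \<sigma> \<longrightarrow>
        (\<omega> \<preceq>\<^sub>w \<sigma> \<longleftrightarrow> (\<forall>d\<ge>1. continuous_inclusion m d \<omega> \<sigma>))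
        \<and> (continuous_inclusion m 1 \<omega> \<sigma> \<longrightarrow> \<omega> \<preceq>\<^sub>w \<sigma>))
     \<and> (general_weight_function \<omega> \<and> general_weight_function \<sigma> \<longrightarrow>
        \<omega> \<preceq>\<^sub>w \<sigma> \<longrightarrow> (\<forall>d\<ge>1. continuous_inclusion m d \<omega> \<sigma>))"
proof -
  have "continuous_inclusion m d \<omega> \<sigma>"
    if "general_weight_function \<omega>" "general_weight_function \<sigma>" "\<omega> \<preceq>\<^sub>w \<sigma>" for d
    using that by (rule weight_le_imp_continuous_inclusion)
  moreover have "\<omega> \<preceq>\<^sub>w \<sigma>"
    if "weight_function \<omega>" "\<exists>H>0. (\<lambda>t. \<omega> (t ^ 2)) \<in> O[at_top](\<lambda>t. \<omega> (H * t))"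
      "general_weight_function \<sigma>" "continuous_inclusion m 1 \<omega> \<sigma>"
    using that continuous_inclusion_imp_weight_le by blast
  ultimately show ?thesis by (auto simp: weight_function_def)
qed

end
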